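(* Let $V$ be a word with $u$ letters $\uparrow$ and $d$ letters $\downarrow$ (in any order), and let $H$ be a word with $r$ letters $\rightarrow$ and $l$ letters $\leftarrow$ (in any order). Then for every integer $k$, the number of shuffles of $V$ and $H$ with signed peak-count equal to $k$ is $$\binom{r+u}{u-k}\binom{l+d}{d+k}.$$
   Context: A shuffle of $V$ and $H$ is a word of length $|V|+|H|$ obtained by interleaving the letters of $V$ and $H$, preserving the order of letters within $V$ and within $H$; there are $\binom{|V|+|H|}{|H|}$ of them (shuffles are counted as distinct interleavings). The signed peak-count of a shuffle $\sigma$ is the number of occurrences of $\uparrow$ immediately followed by $\leftarrow$ in $\sigma$ minus the number of occurrences of $\rightarrow$ immediately followed by $\downarrow$ in $\sigma$. Binomial coefficients $\binom{a}{b}$ are $0$ unless $0\le b\le a$. *)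

theory Defs
  imports Complex_Main
begin

datatype letter = Up | Down | Rightward | Leftward

definition occurrences2 :: "'a \<Rightarrow> 'a \<Rightarrow> 'a list \<Rightarrow> nat" where
  "occurrences2 a b w = card {i. Suc i < length w \<and> w ! i = a \<and> w ! Suc i = b}"

definition signed_peak_count :: "letter list \<Rightarrow> int" where
  "signed_peak_count w = int (occurrences2 Up Leftward w) - int (occurrences2 Rightward Down w)"

(* The library coefficients take a natural-number lower entry; here it may be a negative integer,
   and the coefficient is 0 outside 0 \<le> b \<le> a. *)
definition int_binomial :: "int \<Rightarrow> int \<Rightarrow> nat" where
  "int_binomial a b = (if 0 \<le> b \<and> b \<le> a then nat a choose nat b else 0)"

(* Shuffles are the library set shuffles V H.  It is a set of words, whereas shuffles are to be
   counted as distinct interleavings.  For words over disjoint alphabets, such as vertical and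
   horizontal letters, a word determines its interleaving, so the two counts agree; see
   card_disjoint_shuffles for the resulting total number. *)

end

theory Submission
  imports Defs
begin

text \<open>
  Compare the first letters of \<open>V = v # V'\<close> and \<open>H = h # H'\<close>. Prepending \<open>Down\<close> or
  \<open>Leftward\<close> to a word never changes the signed peak-count, and prepending \<open>Up\<close>
  (\<open>Rightward\<close>) changes it only in front of \<open>Leftward\<close> (\<open>Down\<close>). So, writing \<open>N\<close> for the
  number of shuffles with a given count, \<open>N V H k = N V' H k + N V H' k\<close> unless \<open>(v, h)\<close> is
  \<open>(Up, Leftward)\<close> or \<open>(Down, Rightward)\<close>, where the right-hand side is corrected by
  \<open>N V' H' (k - 1) - N V' H' k\<close> or \<open>N V' H' (k + 1) - N V' H' k\<close> respectively. By Pascal's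
  rule the product of binomial coefficients satisfies the same four recurrences.
\<close>

section \<open>Effect of a prepended letter on the signed peak-count\<close>

lemma occurrences2_Nil [simp]: "occurrences2 a b [] = 0"
  by (simp add: occurrences2_def)

lemma occurrences2_Cons:
  "occurrences2 a b (c # w) =
    (if w \<noteq> [] \<and> c = a \<and> hd w = b then 1 else 0) + occurrences2 a b w"
proof -
  let ?S = "{i. Suc i < length w \<and> w ! i = a \<and> w ! Suc i = b}"
  let ?Z = "if w \<noteq> [] \<and> c = a \<and> hd w = b then {0} else {}"
  have "{i. Suc i < length (c # w) \<and> (c # w) ! i = a \<and> (c # w) ! Suc i = b} = ?Z \<union> Suc ` ?S"
    (is "?L = ?R")
  proof (rule set_eqI)
    fix i
    show "i \<in> ?L \<longleftrightarrow> i \<in> ?R"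
      by (cases i) (auto simp: hd_conv_nth)
  qed
  moreover have "finite ?S"
    by (rule finite_subset[of _ "{..<length w}"]) auto
  ultimately show ?thesis
    by (simp add: occurrences2_def card_Un_disjoint card_image)
qed

lemma signed_peak_count_Nil [simp]: "signed_peak_count [] = 0"
  by (simp add: signed_peak_count_def)

lemma signed_peak_count_Cons:
  "signed_peak_count (a # w) = signed_peak_count w
    + (if w \<noteq> [] \<and> a = Up \<and> hd w = Leftward then 1 else 0)
    - (if w \<noteq> [] \<and> a = Rightward \<and> hd w = Down then 1 else 0)"
  by (auto simp: signed_peak_count_def occurrences2_Cons)

lemma signed_peak_count_vertical:
  "set w \<subseteq> {Up, Down} \<Longrightarrow> signed_peak_count w = 0"
  by (induction w) (auto simp: signed_peak_count_Cons dest: hd_in_set)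

lemma signed_peak_count_horizontal:
  "set w \<subseteq> {Rightward, Leftward} \<Longrightarrow> signed_peak_count w = 0"
  by (induction w) (auto simp: signed_peak_count_Cons dest: hd_in_set)

section \<open>Splitting shuffles by their first letter\<close>

lemma hd_shuffles:
  assumes "w \<in> shuffles xs ys" "w \<noteq> []"
  shows "hd w \<in> set xs \<or> ys \<noteq> [] \<and> hd w = hd ys"
  using assms by (cases w) (auto simp: Cons_in_shuffles_iff)

text \<open>As \<open>b\<close> does not occur in \<open>xs\<close>, a leading \<open>b\<close> can
  only be the head of the second list.\<close>

lemma shuffles_hd_eq:
  assumes "b \<notin> set xs"
  shows "{w \<in> shuffles xs (b # ys). hd w = b} = (#) b ` shuffles xs ys"
proof (rule set_eqI)
  fix w
  show "w \<in> {w \<in> shuffles xs (b # ys). hd w = b} \<longleftrightarrow> w \<in> (#) b ` shuffles xs ys"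
    using assms by (cases w) (auto simp: Cons_in_shuffles_iff)
qed

lemma card_shuffles_Cons:
  assumes "x \<noteq> y"
  shows "card {w \<in> shuffles (x # xs) (y # ys). P w} =
    card {w \<in> shuffles xs (y # ys). P (x # w)} + card {w \<in> shuffles (x # xs) ys. P (y # w)}"
proof -
  let ?A = "{w \<in> shuffles xs (y # ys). P (x # w)}"
  let ?B = "{w \<in> shuffles (x # xs) ys. P (y # w)}"
  have "{w \<in> shuffles (x # xs) (y # ys). P w} = (#) x ` ?A \<union> (#) y ` ?B"
    by auto
  moreover have "card ((#) x ` ?A \<union> (#) y ` ?B) = card ((#) x ` ?A) + card ((#) y ` ?B)"
    using assms by (intro card_Un_disjoint) auto
  ultimately show ?thesis
    by (simp add: card_image)
qed

definition shuffle_count :: "letter list \<Rightarrow> letter list \<Rightarrow> int \<Rightarrow> nat" where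
  "shuffle_count V H k = card {w \<in> shuffles V H. signed_peak_count w = k}"

lemma shuffle_count_Cons_Cons:
  assumes "x \<noteq> y"
  shows "shuffle_count (x # xs) (y # ys) k =
    card {w \<in> shuffles xs (y # ys). signed_peak_count (x # w) = k} +
    card {w \<in> shuffles (x # xs) ys. signed_peak_count (y # w) = k}"
  unfolding shuffle_count_def using assms by (rule card_shuffles_Cons)

lemma shuffle_count_commute: "shuffle_count V H k = shuffle_count H V k"
  by (simp add: shuffle_count_def shuffles_commutes)

lemma card_prepend_no_turn:
  assumes "\<And>w. w \<in> shuffles xs ys \<Longrightarrow> signed_peak_count (a # w) = signed_peak_count w"
  shows "card {w \<in> shuffles xs ys. signed_peak_count (a # w) = k} = shuffle_count xs ys k"
  unfolding shuffle_count_def using assms by (intro arg_cong[of _ _ card]) auto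

text \<open>Shuffles not starting with \<open>b\<close> contribute equally to the first term on each
  side. The others are \<open>b # w\<close> with \<open>w\<close> in \<open>shuffles xs ys\<close>;
  there \<open>w\<close> must have count \<open>k - e\<close> if \<open>a\<close> is prepended and
  \<open>k\<close> if not. The additive form avoids subtraction on naturals, and \<open>e\<close> is
  1 or -1 so that both kinds of turn are covered.\<close>

lemma card_prepend_turn:
  assumes b: "b \<notin> set xs"
    and prepend_b: "\<And>w. signed_peak_count (b # w) = signed_peak_count w"
    and turn: "\<And>w. signed_peak_count (a # b # w) = signed_peak_count w + e"
    and no_turn: "\<And>w. hd w \<noteq> b \<Longrightarrow> signed_peak_count (a # w) = signed_peak_count w"
  shows "card {w \<in> shuffles xs (b # ys). signed_peak_count (a # w) = k} + shuffle_count xs ys k =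
    shuffle_count xs (b # ys) k + shuffle_count xs ys (k - e)"
proof -
  let ?S = "shuffles xs (b # ys)"
  let ?N = "card {w \<in> ?S. hd w \<noteq> b \<and> signed_peak_count w = k}"
  \<comment> \<open>\<open>P\<close> is arbitrary because the split is applied twice, to the count
    with \<open>a\<close> prepended and to the count itself.\<close>
  have split: "card {w \<in> ?S. P w} =
      card {w \<in> ?S. hd w \<noteq> b \<and> P w} + card {w \<in> shuffles xs ys. P (b # w)}" for P
  proof -
    have "{w \<in> ?S. hd w = b \<and> P w} = {w \<in> {w \<in> ?S. hd w = b}. P w}"
      by auto
    also have "\<dots> = (#) b ` {w \<in> shuffles xs ys. P (b # w)}"
      unfolding shuffles_hd_eq[OF b] by auto
    finally have hd: "{w \<in> ?S. hd w = b \<and> P w} = (#) b ` {w \<in> shuffles xs ys. P (b # w)}" .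
    have "{w \<in> ?S. P w} = {w \<in> ?S. hd w \<noteq> b \<and> P w} \<union> {w \<in> ?S. hd w = b \<and> P w}"
      by auto
    moreover have "card \<dots> =
        card {w \<in> ?S. hd w \<noteq> b \<and> P w} + card {w \<in> ?S. hd w = b \<and> P w}"
      by (intro card_Un_disjoint) auto
    ultimately show ?thesis
      by (simp add: hd card_image)
  qed
  have "{w \<in> ?S. hd w \<noteq> b \<and> signed_peak_count (a # w) = k} =
      {w \<in> ?S. hd w \<noteq> b \<and> signed_peak_count w = k}"
    using no_turn by auto
  then have "card {w \<in> ?S. signed_peak_count (a # w) = k} = ?N + shuffle_count xs ys (k - e)"
    using split[of "\<lambda>w. signed_peak_count (a # w) = k"]
    by (simp add: turn shuffle_count_def eq_diff_eq)
  moreover have "shuffle_count xs (b # ys) k = ?N + shuffle_count xs ys k"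
    using split[of "\<lambda>w. signed_peak_count w = k"] by (simp add: prepend_b shuffle_count_def)
  ultimately show ?thesis
    by simp
qed

section \<open>The four recurrences for the number of shuffles\<close>

lemma shuffle_count_Up_Rightward:
  assumes "set V \<subseteq> {Up, Down}" "set H \<subseteq> {Rightward, Leftward}"
  shows "shuffle_count (Up # V) (Rightward # H) k =
    shuffle_count V (Rightward # H) k + shuffle_count (Up # V) H k"
proof -
  \<comment> \<open>The only horizontal letter that can follow the leading \<open>Up\<close> is
    \<open>Rightward\<close>, and the only vertical one that can follow a leading
    \<open>Rightward\<close> is \<open>Up\<close>, so no turn arises.\<close>
  have "signed_peak_count (Up # w) = signed_peak_count w" if "w \<in> shuffles V (Rightward # H)" for w
    using hd_shuffles[OF that] assms by (auto simp: signed_peak_count_Cons)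
  moreover have "signed_peak_count (Rightward # w) = signed_peak_count w"
    if "w \<in> shuffles (Up # V) H" for w
    using hd_shuffles[of w H "Up # V"] that assms
    by (auto simp: signed_peak_count_Cons shuffles_commutes)
  ultimately show ?thesis
    by (simp add: shuffle_count_Cons_Cons card_prepend_no_turn)
qed

lemma shuffle_count_Down_Leftward:
  "shuffle_count (Down # V) (Leftward # H) k =
    shuffle_count V (Leftward # H) k + shuffle_count (Down # V) H k"
  by (subst shuffle_count_Cons_Cons) (simp_all add: shuffle_count_def signed_peak_count_Cons)

lemma shuffle_count_Up_Leftward:
  assumes "set V \<subseteq> {Up, Down}"
  shows "shuffle_count (Up # V) (Leftward # H) k + shuffle_count V H k =
    shuffle_count V (Leftward # H) k + shuffle_count (Up # V) H k + shuffle_count V H (k - 1)"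
proof -
  have "card {w \<in> shuffles V (Leftward # H). signed_peak_count (Up # w) = k} + shuffle_count V H k =
      shuffle_count V (Leftward # H) k + shuffle_count V H (k - 1)"
    by (rule card_prepend_turn) (use assms in \<open>auto simp: signed_peak_count_Cons\<close>)
  moreover have "card {w \<in> shuffles (Up # V) H. signed_peak_count (Leftward # w) = k} =
      shuffle_count (Up # V) H k"
    by (rule card_prepend_no_turn) (simp add: signed_peak_count_Cons)
  ultimately show ?thesis
    by (simp add: shuffle_count_Cons_Cons)
qed

lemma shuffle_count_Down_Rightward:
  assumes "set H \<subseteq> {Rightward, Leftward}"
  shows "shuffle_count (Down # V) (Rightward # H) k + shuffle_count V H k =
    shuffle_count V (Rightward # H) k + shuffle_count (Down # V) H k + shuffle_count V H (k + 1)"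
proof -
  \<comment> \<open>The vertical word goes second because it now supplies the second letter of the
    turn; \<open>e\<close> is -1, as this turn lowers the count.\<close>
  have "card {w \<in> shuffles H (Down # V). signed_peak_count (Rightward # w) = k}
      + shuffle_count H V k = shuffle_count H (Down # V) k + shuffle_count H V (k - (- 1))"
    by (rule card_prepend_turn) (use assms in \<open>auto simp: signed_peak_count_Cons\<close>)
  then have "card {w \<in> shuffles (Down # V) H. signed_peak_count (Rightward # w) = k}
      + shuffle_count V H k = shuffle_count (Down # V) H k + shuffle_count V H (k + 1)"
    by (simp add: shuffles_commutes[of H] shuffle_count_commute[of H])
  moreover have "card {w \<in> shuffles V (Rightward # H). signed_peak_count (Down # w) = k} =
      shuffle_count V (Rightward # H) k"
    by (rule card_prepend_no_turn) (simp add: signed_peak_count_Cons)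
  ultimately show ?thesis
    by (simp add: shuffle_count_Cons_Cons)
qed

section \<open>The same recurrences for the product of binomial coefficients\<close>

lemma int_binomial_pascal:
  assumes "a \<ge> 0"
  shows "int_binomial (a + 1) b = int_binomial a b + int_binomial a (b - 1)"
proof -
  \<comment> \<open>Nonnegativity matters: for \<open>a = -1\<close> and \<open>b = 0\<close> the
    two sides would be 1 and 0.\<close>
  obtain n where n: "a = int n"
    using assms nonneg_int_cases by blast
  consider "b < 0" | "b = 0" | m where "b = int (Suc m)"
    by (metis linorder_neqE_linordered_idom pos_int_cases gr0_implies_Suc)
  then show ?thesis
  proof cases
    case 3
    then show ?thesis
      by (auto simp: int_binomial_def n nat_add_distrib)
  qed (auto simp: int_binomial_def n)
qed

text \<open>The first factor vanishes for \<open>k < 0\<close> and the second for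
  \<open>k > 0\<close>, since the lower entry then exceeds the upper one.\<close>

lemma int_binomial_mult_self:
  "int_binomial (int u) (int u - k) * int_binomial (int d) (int d + k) = (if k = 0 then 1 else 0)"
  by (auto simp: int_binomial_def)

definition peak_formula :: "nat \<Rightarrow> nat \<Rightarrow> nat \<Rightarrow> nat \<Rightarrow> int \<Rightarrow> nat" where
  "peak_formula u d r l k =
    int_binomial (int r + int u) (int u - k) * int_binomial (int l + int d) (int d + k)"

lemma peak_formula_Up_Rightward:
  "peak_formula (Suc u) d (Suc r) l k = peak_formula u d (Suc r) l k + peak_formula (Suc u) d r l k"
  using int_binomial_pascal[of "int r + int u + 1" "int u + 1 - k"]
  by (simp add: peak_formula_def algebra_simps)

lemma peak_formula_Down_Leftward:
  "peak_formula u (Suc d) r (Suc l) k = peak_formula u d r (Suc l) k + peak_formula u (Suc d) r l k"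
  using int_binomial_pascal[of "int l + int d + 1" "int d + 1 + k"]
  by (simp add: peak_formula_def algebra_simps)

text \<open>With A = C(r+u, u-k), A' = C(r+u, u+1-k), B = C(l+d, d+k) and B' = C(l+d, d+k-1),
  Pascal's rule reduces the claim to (A+A')(B+B') + AB = A(B+B') + (A+A')B + A'B'.\<close>

lemma peak_formula_Up_Leftward:
  "peak_formula (Suc u) d r (Suc l) k + peak_formula u d r l k =
    peak_formula u d r (Suc l) k + peak_formula (Suc u) d r l k + peak_formula u d r l (k - 1)"
  using int_binomial_pascal[of "int r + int u" "int u + 1 - k"]
    int_binomial_pascal[of "int l + int d" "int d + k"]
  by (simp add: peak_formula_def algebra_simps)

lemma peak_formula_Down_Rightward:
  "peak_formula u (Suc d) (Suc r) l k + peak_formula u d r l k =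
    peak_formula u d (Suc r) l k + peak_formula u (Suc d) r l k + peak_formula u d r l (k + 1)"
  using int_binomial_pascal[of "int r + int u" "int u - k"]
    int_binomial_pascal[of "int l + int d" "int d + 1 + k"]
  by (simp add: peak_formula_def algebra_simps)

section \<open>Induction matching the two sides\<close>

lemma shuffle_count_eq_peak_formula:
  assumes "set V \<subseteq> {Up, Down}" "set H \<subseteq> {Rightward, Leftward}"
  shows "shuffle_count V H k = peak_formula (count_list V Up) (count_list V Down)
    (count_list H Rightward) (count_list H Leftward) k"
  using assms
\<comment> \<open>The recurrences shorten \<open>V\<close>, \<open>H\<close> or both, so the total
  length is the measure; \<open>k\<close> varies because the corrections shift it.\<close>
proof (induction "length V + length H" arbitrary: V H k rule: less_induct)
  case less
  show ?case
  proof (cases "V = [] \<or> H = []")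
    case True
    then have "{w \<in> shuffles V H. signed_peak_count w = k} = (if k = 0 then {V @ H} else {})"
      using less.prems by (auto simp: signed_peak_count_vertical signed_peak_count_horizontal)
    \<comment> \<open>For empty \<open>H\<close> the upper entries are u and d. For empty
      \<open>V\<close> the formula is C(r, -k) C(l, k), whose lower entries are both nonnegative
      only for \<open>k = 0\<close>.\<close>
    with True show ?thesis
      using int_binomial_mult_self[of "count_list V Up" k "count_list V Down"]
        int_binomial_mult_self[of "count_list H Leftward" k "count_list H Rightward"]
      by (auto simp: shuffle_count_def peak_formula_def int_binomial_def)
  next
    case False
    then obtain v V' h H' where VH: "V = v # V'" "H = h # H'"
      by (auto simp: neq_Nil_conv)
    have sub: "set V' \<subseteq> {Up, Down}" "set H' \<subseteq> {Rightward, Leftward}"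
      using less.prems VH by auto
    note IH = less.hyps[of V' H] less.hyps[of V H'] less.hyps[of V' H']
    note IH = IH[unfolded VH, simplified]
    consider "v = Up" "h = Rightward" | "v = Up" "h = Leftward"
      | "v = Down" "h = Rightward" | "v = Down" "h = Leftward"
      using less.prems VH by auto
    then show ?thesis
    proof cases
      case 1
      then show ?thesis
        using sub IH by (simp add: VH shuffle_count_Up_Rightward peak_formula_Up_Rightward)
    next
      case 2
      then show ?thesis
        using sub IH shuffle_count_Up_Leftward[OF sub(1), of H' k]
          peak_formula_Up_Leftward[of "count_list V' Up" "count_list V' Down"
            "count_list H' Rightward" "count_list H' Leftward" k]
        by (simp add: VH)
    next
      case 3
      then show ?thesis
        using sub IH shuffle_count_Down_Rightward[OF sub(2), of V' k]
          peak_formula_Down_Rightward[of "count_list V' Up" "count_list V' Down"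
            "count_list H' Rightward" "count_list H' Leftward" k]
        by (simp add: VH)
    next
      case 4
      then show ?thesis
        using sub IH by (simp add: VH shuffle_count_Down_Leftward peak_formula_Down_Leftward)
    qed
  qed
qed

theorem theorem2p16:
  fixes V H :: "letter list" and u d r l :: nat and k :: int
  assumes "set V \<subseteq> {Up, Down}"
    and "count_list V Up = u" and "count_list V Down = d"
    and "set H \<subseteq> {Rightward, Leftward}"
    and "count_list H Rightward = r" and "count_list H Leftward = l"
  shows "card {\<sigma> \<in> shuffles V H. signed_peak_count \<sigma> = k} =
    int_binomial (int r + int u) (int u - k) * int_binomial (int l + int d) (int d + k)"
  using shuffle_count_eq_peak_formula[OF assms(1,4), of k] assms
  by (simp add: shuffle_count_def peak_formula_def)

end
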